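(* For a field $\mathrm{k}$, a commutative field extension $K$ of $\mathrm{k}$, an integer $n\geq1$ and finite nonempty subsets $A_{1},\ldots,A_{n}$ of $K^{\ast}=K\setminus\{0\}$, set $H:=H_{\mathrm{k}}(A_{1}\cdots A_{n})$ and consider the conditions (C1) $\dim_{\mathrm{k}}(A_{1}\cdots A_{n})\geq\sum_{i=1}^{n}\dim_{\mathrm{k}}(A_{i}H)-(n-1)\dim_{\mathrm{k}}(H)$; (C2) $\dim_{\mathrm{k}}(A_{1}\cdots A_{n})\geq\sum_{i=1}^{n}\dim_{\mathrm{k}}(A_{i})-(n-1)\dim_{\mathrm{k}}(H)$; (C3) either $\dim_{\mathrm{k}}(A_{1}\cdots A_{n})\geq\sum_{i=1}^{n}\dim_{\mathrm{k}}(A_{i})-(n-1)$, or $\mathrm{k}\langle A_{1}\cdots A_{n}\rangle$ is periodic. For $i\in\{1,2,3\}$ let $(S_i)$ be the assertion "(C$i$) holds for every field $\mathrm{k}$, every commutative field extension $K$ of $\mathrm{k}$, every $n\geq1$ and all finite nonempty $A_{1},\ldots,A_{n}\subseteq K^{\ast}$", and let $(S_i')$ be the same assertion restricted to $n=2$. Then the six assertions $(S_1),(S_2),(S_3),(S_1'),(S_2'),(S_3')$ are all equivalent.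
   Context: For $X\subseteq K$, $\mathrm{k}\langle X\rangle$ is the $\mathrm{k}$-linear span of $X$ and $\dim_{\mathrm{k}}(X)$ its dimension over $\mathrm{k}$. Products of sets are Minkowski products: $XY=\{xy\mid x\in X,y\in Y\}$, and $A_1\cdots A_n$ similarly. For a subset $X$ of $K^{\ast}$, $H_{\mathrm{k}}(X):=\{h\in K\mid h\,\mathrm{k}\langle X\rangle\subseteq\mathrm{k}\langle X\rangle\}$, the stabilizer of $\mathrm{k}\langle X\rangle$, which is an intermediate field $\mathrm{k}\subseteq H_{\mathrm{k}}(X)\subseteq K$. The space $\mathrm{k}\langle X\rangle$ is called periodic if $H_{\mathrm{k}}(X)\neq\mathrm{k}$. No separability assumption is made. *)

theory Defs
  imports "HOL-Algebra.Embedded_Algebras"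
begin

context ring
begin

(* The library's Span takes a finite list of generators; an arbitrary set is spanned by the
   union of the spans of the finite lists of its elements. *)
definition lin_span :: "'a set \<Rightarrow> 'a set \<Rightarrow> 'a set" where
  "lin_span k X = (\<Union>Us \<in> {Us. set Us \<subseteq> X}. Span k Us)"

(* Meaningful only if the span is finite-dimensional (dim is a definite description).  This is
   the case for all sets in the conditions below: the stabilizer of a nonzero
   finite-dimensional space is itself finite-dimensional. *)
definition span_dim :: "'a set \<Rightarrow> 'a set \<Rightarrow> nat" where
  "span_dim k X = dim k (lin_span k X)"

definition stabilizer :: "'a set \<Rightarrow> 'a set \<Rightarrow> 'a set" where
  "stabilizer k X = {h \<in> carrier R. h <# lin_span k X \<subseteq> lin_span k X}"

definition periodic :: "'a set \<Rightarrow> 'a set \<Rightarrow> bool" where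
  "periodic k X \<longleftrightarrow> stabilizer k X \<noteq> k"

(* A 1 <#> ... <#> A n; families are indexed from 1 *)
primrec minkowski_prod :: "(nat \<Rightarrow> 'a set) \<Rightarrow> nat \<Rightarrow> 'a set" where
  "minkowski_prod A 0 = {\<one>}"
| "minkowski_prod A (Suc n) = minkowski_prod A n <#> A (Suc n)"

(* The right-hand sides may be negative, hence the integers. *)
definition cond1 :: "'a set \<Rightarrow> nat \<Rightarrow> (nat \<Rightarrow> 'a set) \<Rightarrow> bool" where
  "cond1 k n A \<longleftrightarrow>
    (let P = minkowski_prod A n; H = stabilizer k P in
      int (span_dim k P) \<ge>
        (\<Sum>i = 1..n. int (span_dim k (A i <#> H))) - (int n - 1) * int (span_dim k H))"

definition cond2 :: "'a set \<Rightarrow> nat \<Rightarrow> (nat \<Rightarrow> 'a set) \<Rightarrow> bool" where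
  "cond2 k n A \<longleftrightarrow>
    (let P = minkowski_prod A n; H = stabilizer k P in
      int (span_dim k P) \<ge>
        (\<Sum>i = 1..n. int (span_dim k (A i))) - (int n - 1) * int (span_dim k H))"

definition cond3 :: "'a set \<Rightarrow> nat \<Rightarrow> (nat \<Rightarrow> 'a set) \<Rightarrow> bool" where
  "cond3 k n A \<longleftrightarrow>
    (let P = minkowski_prod A n in
      int (span_dim k P) \<ge> (\<Sum>i = 1..n. int (span_dim k (A i))) - (int n - 1)
      \<or> periodic k P)"

end

(* C holds for all field extensions K / k with K carried by a subset of the type 'a, all n in N
   with n >= 1, and all finite nonempty A 1, ..., A n consisting of nonzero elements of K. *)
definition holds_for_all ::
    "('a ring \<Rightarrow> 'a set \<Rightarrow> nat \<Rightarrow> (nat \<Rightarrow> 'a set) \<Rightarrow> bool) \<Rightarrow> nat set \<Rightarrow> bool" where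
  "holds_for_all C N \<longleftrightarrow>
    (\<forall>(K :: 'a ring) k n A.
      field K \<longrightarrow> subfield k K \<longrightarrow> n \<in> N \<longrightarrow> n \<ge> 1 \<longrightarrow>
      (\<forall>i \<in> {1..n}. finite (A i) \<and> A i \<noteq> {} \<and> A i \<subseteq> carrier K - {\<zero>\<^bsub>K\<^esub>}) \<longrightarrow>
      C K k n A)"

definition S1 :: "'a itself \<Rightarrow> bool" where
  "S1 _ \<longleftrightarrow> holds_for_all (ring.cond1 :: 'a ring \<Rightarrow> _) {1..}"

definition S2 :: "'a itself \<Rightarrow> bool" where
  "S2 _ \<longleftrightarrow> holds_for_all (ring.cond2 :: 'a ring \<Rightarrow> _) {1..}"

definition S3 :: "'a itself \<Rightarrow> bool" where
  "S3 _ \<longleftrightarrow> holds_for_all (ring.cond3 :: 'a ring \<Rightarrow> _) {1..}"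

definition S1' :: "'a itself \<Rightarrow> bool" where
  "S1' _ \<longleftrightarrow> holds_for_all (ring.cond1 :: 'a ring \<Rightarrow> _) {2}"

definition S2' :: "'a itself \<Rightarrow> bool" where
  "S2' _ \<longleftrightarrow> holds_for_all (ring.cond2 :: 'a ring \<Rightarrow> _) {2}"

definition S3' :: "'a itself \<Rightarrow> bool" where
  "S3' _ \<longleftrightarrow> holds_for_all (ring.cond3 :: 'a ring \<Rightarrow> _) {2}"

end

theory Submission
  imports Defs
begin

(* For n = 2 and for every n alike, condition 3 over the larger base field H = H_k(A_1 ... A_n)
   gives condition 1 over k: the span of the product is already an H-space whose stabilizer is H,
   so it is not periodic over H, and multiplying the resulting inequality by [H : k] turns
   H-dimensions into k-dimensions.  Conditions 2 and 3 are successive weakenings of condition 1.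
   The passage from n = 2 to general n is an induction on condition 3, where the stabilizer of a
   partial product is contained in that of the whole product, so that a nonperiodic product has
   nonperiodic partial products. *)

section \<open>Finite-dimensional subspaces\<close>

text \<open>Negatives come from the scalar action: the subfield contains
  \<open>\<ominus> \<one>\<close>, and multiplying by it negates a vector.\<close>

lemma (in ring) subalgebraI:
  assumes "subfield K R" "V \<subseteq> carrier R" "\<zero> \<in> V"
    and "\<And>u v. u \<in> V \<Longrightarrow> v \<in> V \<Longrightarrow> u \<oplus> v \<in> V"
    and "\<And>k v. k \<in> K \<Longrightarrow> v \<in> V \<Longrightarrow> k \<otimes> v \<in> V"
  shows "subalgebra K V R"
proof -
  have "\<ominus> v \<in> V" if "v \<in> V" for v
  proof -
    have "\<ominus> \<one> \<in> K"
      using subringE(3,5)[OF subfieldE(1)[OF assms(1)]] by blast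
    moreover have "\<ominus> v = (\<ominus> \<one>) \<otimes> v"
      using that assms(2) by (simp add: l_minus subsetD)
    ultimately show ?thesis
      using assms(5) that by simp
  qed
  then have "subgroup V (add_monoid R)"
    using assms(2-4) by (intro add.subgroupI) auto
  then show ?thesis
    unfolding subalgebra_def subalgebra_axioms_def using assms(5) by blast
qed

lemma (in ring) subalgebraD:
  assumes "subalgebra K V R"
  shows "V \<subseteq> carrier R" "\<zero> \<in> V"
    and "\<And>u v. u \<in> V \<Longrightarrow> v \<in> V \<Longrightarrow> u \<oplus> v \<in> V"
    and "\<And>v. v \<in> V \<Longrightarrow> \<ominus> v \<in> V"
    and "\<And>k v. k \<in> K \<Longrightarrow> v \<in> V \<Longrightarrow> k \<otimes> v \<in> V"
proof -
  interpret V: subalgebra K V R by fact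
  show "V \<subseteq> carrier R" "\<zero> \<in> V" "\<And>u v. u \<in> V \<Longrightarrow> v \<in> V \<Longrightarrow> u \<oplus> v \<in> V"
    "\<And>k v. k \<in> K \<Longrightarrow> v \<in> V \<Longrightarrow> k \<otimes> v \<in> V"
    using V.subset V.one_closed V.m_closed V.smult_closed by auto
  show "\<And>v. v \<in> V \<Longrightarrow> \<ominus> v \<in> V"
    using V.subgroup_axioms add.subgroupE(3) by blast
qed

lemma (in ring) dimension_mono:
  assumes "subfield K R" "dimension n K V" "dimension m K E" "V \<subseteq> E"
  shows "n \<le> m"
proof -
  obtain Us where "set Us \<subseteq> carrier R" "independent K Us" "length Us = n" "Span K Us = V"
    using exists_base[OF assms(1,2)] by blast
  then show ?thesis
    using independent_length_le_dimension[OF assms(1,3), of Us] Span_base_incl[OF assms(1), of Us]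
      assms(4) by auto
qed

lemma (in ring) dimension_eq_imp_eq:
  assumes "subfield K R" "dimension n K V" "dimension n K E" "V \<subseteq> E"
  shows "V = E"
proof -
  obtain Us where "set Us \<subseteq> carrier R" "independent K Us" "length Us = n" "Span K Us = V"
    using exists_base[OF assms(1,2)] by blast
  then show ?thesis
    using independent_length_eq_dimension[OF assms(1,3), of Us]
      Span_base_incl[OF assms(1), of Us] assms(4) by auto
qed

text \<open>Multiplication by a nonzero \<open>a\<close> is linear and injective, so it carries the
  chain of line extensions that builds \<open>E\<close> to one of the same length building
  \<open>a <# E\<close>.\<close>

lemma (in domain) dimension_l_coset:
  assumes "subfield K R" "a \<in> carrier R" "a \<noteq> \<zero>" "dimension n K E"
  shows "dimension n K (a <# E)"
  using assms(4,1)
proof (induction n K E rule: dimension.induct)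
  case (zero_dim K)
  have "a <# {\<zero>} = {\<zero>}"
    using assms(2) by (simp add: l_coset_def)
  then show ?case by simp
next
  case (Suc_dim v E n K)
  have E: "E \<subseteq> carrier R"
    using space_subgroup_props(1)[OF Suc_dim.prems Suc_dim.hyps(3)] .
  have K: "K \<subseteq> carrier R"
    using subfieldE(3)[OF Suc_dim.prems] .
  have eq: "a \<otimes> (k \<otimes> v \<oplus> e) = k \<otimes> (a \<otimes> v) \<oplus> a \<otimes> e" if "k \<in> K" "e \<in> E" for k e
    using that K E assms(2) Suc_dim.hyps(1) by (simp add: subsetD r_distr m_lcomm)
  have "a <# line_extension K v E = line_extension K (a \<otimes> v) (a <# E)" (is "?l = ?r")
  proof (intro equalityI subsetI)
    fix x assume "x \<in> ?l"
    then obtain k e where "k \<in> K" "e \<in> E" "x = a \<otimes> (k \<otimes> v \<oplus> e)"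
      by (auto simp: l_coset_def line_extension_mem_iff)
    then show "x \<in> ?r"
      by (auto simp: l_coset_def line_extension_mem_iff eq)
  next
    fix x assume "x \<in> ?r"
    then obtain k e where "k \<in> K" "e \<in> E" "x = k \<otimes> (a \<otimes> v) \<oplus> a \<otimes> e"
      by (auto simp: l_coset_def line_extension_mem_iff)
    then have "k \<otimes> v \<oplus> e \<in> line_extension K v E" "x = a \<otimes> (k \<otimes> v \<oplus> e)"
      using eq by (auto simp: line_extension_mem_iff)
    then show "x \<in> ?l"
      unfolding l_coset_def by blast
  qed
  \<comment> \<open>Cancelling \<open>a\<close> keeps the new vector outside the image of the
    smaller space.\<close>
  moreover have "a \<otimes> v \<notin> a <# E"
    using Suc_dim.hyps(1,2) assms(2,3) E m_lcancel[OF assms(3,2)] by (auto simp: l_coset_def subsetD)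
  ultimately show ?case
    using dimension.Suc_dim[of "a \<otimes> v" "a <# E" n K] Suc_dim assms(2) by simp
qed

text \<open>Together with \<open>lin_span_minimal\<close> this lets one check that multiplication by
  \<open>a\<close> maps a whole span into \<open>E\<close> by looking at the generators
  alone.\<close>

lemma (in cring) subalgebra_vimage_mult:
  assumes "subfield K R" "subalgebra K E R" "a \<in> carrier R"
  shows "subalgebra K {v \<in> carrier R. a \<otimes> v \<in> E} R"
  using subfieldE(3)[OF assms(1)] subalgebraD[OF assms(2)] assms(3)
  by (intro subalgebraI[OF assms(1)]) (auto simp: r_distr m_lcomm subsetD)

section \<open>Linear spans\<close>

lemma (in ring) lin_span_set:
  assumes "subfield k R" "set Us \<subseteq> carrier R"
  shows "lin_span k (set Us) = Span k Us"
  using mono_Span_sublist[OF assms(1) _ assms(2)] by (auto simp: lin_span_def)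

lemma (in ring) lin_span_incl:
  assumes "subfield k R" "X \<subseteq> carrier R"
  shows "X \<subseteq> lin_span k X"
proof
  fix x assume "x \<in> X"
  then show "x \<in> lin_span k X"
    using Span_base_incl[OF assms(1), of "[x]"] assms(2) unfolding lin_span_def
    by (intro UN_I[of "[x]"]) auto
qed

lemma (in ring) lin_span_minimal:
  assumes "subfield k R" "subalgebra k V R" "X \<subseteq> V"
  shows "lin_span k X \<subseteq> V"
  using subalgebra_Span_incl[OF assms(1,2)] assms(3) unfolding lin_span_def by blast

lemma (in ring) lin_span_is_subalgebra:
  assumes "subfield k R" "X \<subseteq> carrier R"
  shows "subalgebra k (lin_span k X) R"
proof (rule subalgebraI[OF assms(1)])
  show "lin_span k X \<subseteq> carrier R"
    using lin_span_minimal[OF assms(1) carrier_is_subalgebra] subfieldE(3)[OF assms(1)] assms(2)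
    by blast
  have "\<zero> \<in> Span k []" by simp
  then show "\<zero> \<in> lin_span k X"
    unfolding lin_span_def by (intro UN_I[of "[]"]) auto
  fix u v assume "u \<in> lin_span k X" "v \<in> lin_span k X"
  then obtain Us Vs where *: "set Us \<subseteq> X" "u \<in> Span k Us" "set Vs \<subseteq> X" "v \<in> Span k Vs"
    unfolding lin_span_def by blast
  then have "u \<in> Span k (Us @ Vs)" "v \<in> Span k (Us @ Vs)"
    using mono_Span_append[OF assms(1), of Us Vs] mono_Span_append[OF assms(1), of Vs Us] assms(2)
    by blast+
  then have "u \<oplus> v \<in> Span k (Us @ Vs)"
    using * assms(2) by (intro Span_subgroup_props(3)[OF assms(1)]) auto
  then show "u \<oplus> v \<in> lin_span k X"
    unfolding lin_span_def using * by (intro UN_I[of "Us @ Vs"]) auto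
next
  fix c v assume "c \<in> k" "v \<in> lin_span k X"
  then obtain Vs where "set Vs \<subseteq> X" "v \<in> Span k Vs"
    unfolding lin_span_def by blast
  then show "c \<otimes> v \<in> lin_span k X"
    using Span_smult_closed[OF assms(1), of Vs c v] \<open>c \<in> k\<close> assms(2) unfolding lin_span_def by blast
qed

lemma (in ring) lin_span_subalgebra_eq:
  assumes "subfield k R" "subalgebra k V R"
  shows "lin_span k V = V"
  using lin_span_incl[OF assms(1)] lin_span_minimal[OF assms] subalgebraD(1)[OF assms(2)] by blast

lemma (in ring) finite_dimension_lin_span:
  assumes "subfield k R" "X \<subseteq> carrier R" "finite X"
  shows "finite_dimension k (lin_span k X)"
  using assms finite_list[of X] lin_span_set Span_finite_dimension by metis

lemma (in ring) subalgebra_restrict_scalars: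
  assumes "subalgebra F V R" "K \<subseteq> F"
  shows "subalgebra K V R"
  using assms unfolding subalgebra_def subalgebra_axioms_def by blast

text \<open>A \<open>k\<close>-combination of products of elements of \<open>X\<close> with elements
  of \<open>F\<close> is an \<open>F\<close>-combination of elements of \<open>X\<close>, and
  conversely. This puts the sets \<open>A i <#> H\<close> of condition 1 within reach of the tower
  law.\<close>

lemma (in cring) lin_span_set_mult_subfield:
  assumes "subfield k R" "subfield F R" "k \<subseteq> F" "X \<subseteq> carrier R"
  shows "lin_span k (X <#> F) = lin_span F X"
proof
  have F: "F \<subseteq> carrier R"
    using subfieldE(3)[OF assms(2)] .
  have S: "subalgebra F (lin_span F X) R"
    using lin_span_is_subalgebra[OF assms(2,4)] .
  have "x \<otimes> h \<in> lin_span F X" if "x \<in> X" "h \<in> F" for x h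
    using subalgebraD(5)[OF S that(2), of x] lin_span_incl[OF assms(2,4)] that F assms(4)
      m_comm[of x h] by (simp add: subsetD)
  then have "X <#> F \<subseteq> lin_span F X"
    unfolding set_mult_def by blast
  then show "lin_span k (X <#> F) \<subseteq> lin_span F X"
    using lin_span_minimal[OF assms(1) subalgebra_restrict_scalars[OF S assms(3)]] by blast
  have XF: "X <#> F \<subseteq> carrier R"
    using set_mult_closed[OF assms(4) F] .
  \<comment> \<open>The \<open>F\<close>-span lies in every additive subgroup that contains the
    products of scalars with generators, so it is enough to locate those products.\<close>
  have "Span F Us \<subseteq> lin_span k (X <#> F)" if "set Us \<subseteq> X" for Us
  proof (rule Span_min[OF assms(2)])
    show "set Us \<subseteq> carrier R" using that assms(4) by blast
    show "subgroup (lin_span k (X <#> F)) (add_monoid R)"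
      using lin_span_is_subalgebra[OF assms(1) XF] by (simp add: subalgebra_def)
    have "h \<otimes> x \<in> X <#> F" if "h \<in> F" "x \<in> X" for h x
      using that m_comm[of h x] F assms(4) by (auto simp: set_mult_def)
    then have "F <#> set Us \<subseteq> X <#> F"
      unfolding set_mult_def[of _ F "set Us"] using \<open>set Us \<subseteq> X\<close> by blast
    then show "F <#> set Us \<subseteq> lin_span k (X <#> F)"
      using lin_span_incl[OF assms(1) XF] by blast
  qed
  then show "lin_span F X \<subseteq> lin_span k (X <#> F)"
    unfolding lin_span_def[of F X] by blast
qed

lemma (in ring) span_dim_mono:
  assumes "subfield k R" "finite_dimension k (lin_span k Y)" "X \<subseteq> Y" "Y \<subseteq> carrier R"
  shows "span_dim k X \<le> span_dim k Y"
proof -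
  have "X \<subseteq> carrier R" using assms(3,4) by blast
  have sub: "lin_span k X \<subseteq> lin_span k Y"
    using assms(3) unfolding lin_span_def by blast
  then have "finite_dimension k (lin_span k X)"
    using subalbegra_incl_imp_finite_dimension[OF assms(1,2)]
      lin_span_is_subalgebra[OF assms(1) \<open>X \<subseteq> carrier R\<close>] by blast
  then show ?thesis
    using dimension_mono[OF assms(1) _ _ sub] finite_dimensionE[OF assms(1)] assms(2)
    unfolding span_dim_def over_def by blast
qed

section \<open>The stabilizer\<close>

text \<open>The vectors that \<open>h\<close> multiplies into the span form a subspace, so they
  include the whole span as soon as they include \<open>X\<close>.\<close>

lemma (in cring) stabilizer_iff:
  assumes "subfield k R" "X \<subseteq> carrier R"
  shows "h \<in> stabilizer k X \<longleftrightarrow> h \<in> carrier R \<and> (\<forall>x\<in>X. h \<otimes> x \<in> lin_span k X)"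
proof
  assume "h \<in> stabilizer k X"
  then show "h \<in> carrier R \<and> (\<forall>x\<in>X. h \<otimes> x \<in> lin_span k X)"
    using lin_span_incl[OF assms] by (auto simp: stabilizer_def l_coset_def)
next
  assume h: "h \<in> carrier R \<and> (\<forall>x\<in>X. h \<otimes> x \<in> lin_span k X)"
  have "lin_span k X \<subseteq> {v \<in> carrier R. h \<otimes> v \<in> lin_span k X}"
    using h assms(2)
    by (intro lin_span_minimal[OF assms(1)] subalgebra_vimage_mult lin_span_is_subalgebra assms) auto
  then show "h \<in> stabilizer k X"
    using h by (auto simp: stabilizer_def l_coset_def)
qed

lemma (in cring) subfield_subset_stabilizer:
  assumes "subfield k R" "X \<subseteq> carrier R"
  shows "k \<subseteq> stabilizer k X"
  using subalgebraD(5)[OF lin_span_is_subalgebra[OF assms]] subfieldE(3)[OF assms(1)]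
  by (auto simp: stabilizer_def l_coset_def)

text \<open>For fixed \<open>y\<close> in \<open>Y\<close>, multiplication by \<open>y\<close> sends
  \<open>X\<close>, hence its span, into the span of \<open>X <#> Y\<close>. Applied to
  \<open>h \<otimes> x\<close>, which lies in the span of \<open>X\<close>, it shows that
  \<open>h\<close> moves \<open>x \<otimes> y\<close> within the span of the product.\<close>

lemma (in cring) stabilizer_subset_stabilizer_set_mult:
  assumes "subfield k R" "X \<subseteq> carrier R" "Y \<subseteq> carrier R"
  shows "stabilizer k X \<subseteq> stabilizer k (X <#> Y)"
proof
  have XY: "X <#> Y \<subseteq> carrier R"
    using set_mult_closed[OF assms(2,3)] .
  fix h assume "h \<in> stabilizer k X"
  then have h: "h \<in> carrier R" "\<And>x. x \<in> X \<Longrightarrow> h \<otimes> x \<in> lin_span k X"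
    using stabilizer_iff[OF assms(1,2)] by auto
  have "h \<otimes> (x \<otimes> y) \<in> lin_span k (X <#> Y)" if xy: "x \<in> X" "y \<in> Y" for x y
  proof -
    have c: "x \<in> carrier R" "y \<in> carrier R"
      using xy assms by auto
    have "y \<otimes> x' \<in> lin_span k (X <#> Y)" if "x' \<in> X" for x'
    proof -
      have "y \<otimes> x' = x' \<otimes> y"
        using that c assms(2) by (auto intro: m_comm)
      then have "y \<otimes> x' \<in> X <#> Y"
        using that xy(2) by (auto simp: set_mult_def)
      then show ?thesis
        using lin_span_incl[OF assms(1) XY] by blast
    qed
    then have "lin_span k X \<subseteq> {v \<in> carrier R. y \<otimes> v \<in> lin_span k (X <#> Y)}"
      using assms(2) c
      by (intro lin_span_minimal[OF assms(1)] subalgebra_vimage_mult lin_span_is_subalgebra XY assms)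
        auto
    then have "y \<otimes> (h \<otimes> x) \<in> lin_span k (X <#> Y)"
      using h(2)[OF xy(1)] by blast
    then show ?thesis
      using c h(1) by (simp add: m_ac)
  qed
  then show "h \<in> stabilizer k (X <#> Y)"
    unfolding stabilizer_iff[OF assms(1) XY] using h(1) by (auto simp: set_mult_def)
qed

text \<open>The ring operations are immediate; inverses rest on finite dimension. A nonzero
  \<open>h\<close> maps the span injectively into itself, hence onto itself by comparing dimensions,
  so its inverse preserves the span as well.\<close>

lemma (in field) subfield_stabilizer:
  assumes k: "subfield k R" and X: "X \<subseteq> carrier R" "finite X"
  shows "subfield (stabilizer k X) R"
proof (rule subfieldI'[OF subringI])
  let ?V = "lin_span k X"
  note V = subalgebraD[OF lin_span_is_subalgebra[OF k X(1)]]
  have iff: "h \<in> stabilizer k X \<longleftrightarrow> h \<in> carrier R \<and> (\<forall>v\<in>?V. h \<otimes> v \<in> ?V)" for h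
    by (auto simp: stabilizer_def l_coset_def)
  show carr: "stabilizer k X \<subseteq> carrier R"
    by (auto simp: stabilizer_def)
  show "\<one> \<in> stabilizer k X"
    using V(1) by (auto simp: iff subsetD)
  show "\<ominus> h \<in> stabilizer k X" if "h \<in> stabilizer k X" for h
    using that V(1,4) by (auto simp: iff l_minus subsetD)
  show "h \<otimes> h' \<in> stabilizer k X" if "h \<in> stabilizer k X" "h' \<in> stabilizer k X" for h h'
    using that V(1) by (auto simp: iff m_assoc subsetD)
  show "h \<oplus> h' \<in> stabilizer k X" if "h \<in> stabilizer k X" "h' \<in> stabilizer k X" for h h'
    using that V(1,3) by (auto simp: iff l_distr subsetD)
  fix h assume h: "h \<in> stabilizer k X - {\<zero>}"
  then have hu: "h \<in> Units R" and hc: "h \<in> carrier R"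
    using carr field_Units by auto
  obtain n where n: "dimension n k ?V"
    using finite_dimension_lin_span[OF k X] by blast
  have "h <# ?V = ?V"
    using dimension_eq_imp_eq[OF k dimension_l_coset[OF k hc _ n] n] h
    by (auto simp: stabilizer_def)
  then have "inv h \<otimes> v \<in> ?V" if v: "v \<in> ?V" for v
  proof -
    obtain w where "w \<in> ?V" "v = h \<otimes> w"
      using v \<open>h <# ?V = ?V\<close> by (auto simp: l_coset_def)
    then have "inv h \<otimes> v = w"
      using V(1) hu hc by (auto simp: m_assoc[symmetric] subsetD)
    then show ?thesis
      using \<open>w \<in> ?V\<close> by simp
  qed
  then show "inv h \<in> stabilizer k X"
    using hu by (simp add: iff)
qed

text \<open>Multiplication by a nonzero element of \<open>X\<close> embeds the stabilizer into the span of \<open>X\<close>.\<close>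

lemma (in field) finite_dimension_stabilizer:
  assumes k: "subfield k R" and X: "X \<subseteq> carrier R" "finite X" and x: "x \<in> X" "x \<noteq> \<zero>"
  shows "finite_dimension k (stabilizer k X)"
proof -
  let ?H = "stabilizer k X"
  have xc: "x \<in> carrier R" and xu: "x \<in> Units R"
    using x X(1) field_Units by auto
  have "subalgebra k ?H R"
    using subfield_subset_stabilizer[OF k X(1)] subringE(1,2,6,7)[OF subfieldE(1)[OF subfield_stabilizer[OF k X]]]
    by (intro subalgebraI[OF k]) auto
  \<comment> \<open>\<open>?W\<close> is \<open>x\<close> times the stabilizer, written as a
    preimage so that it is visibly a subspace.\<close>
  then have sub: "subalgebra k {v \<in> carrier R. inv x \<otimes> v \<in> ?H} R" (is "subalgebra k ?W R")
    using subalgebra_vimage_mult[OF k] xu by simp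
  have "v \<in> lin_span k X" if "v \<in> ?W" for v
  proof -
    have "(inv x \<otimes> v) \<otimes> x \<in> lin_span k X"
      using that stabilizer_iff[OF k X(1)] x(1) by blast
    moreover have "(inv x \<otimes> v) \<otimes> x = (x \<otimes> inv x) \<otimes> v"
      using that xc Units_inv_closed[OF xu] by (simp add: m_ac)
    ultimately show ?thesis
      using that Units_r_inv[OF xu] by simp
  qed
  then have "finite_dimension k ?W"
    using subalbegra_incl_imp_finite_dimension[OF k finite_dimension_lin_span[OF k X] sub] by blast
  then obtain n where "dimension n k ?W" by blast
  moreover have "inv x \<noteq> \<zero>"
    using xu xc Units_r_inv[OF xu] x(2) by force
  \<comment> \<open>Multiplying back by the inverse of \<open>x\<close> preserves the dimension and
    recovers \<open>?H\<close>.\<close>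
  ultimately have "dimension n k (inv x <# ?W)"
    using dimension_l_coset[OF k] xu by simp
  moreover have "inv x <# ?W = ?H"
  proof -
    have "h \<in> inv x <# ?W" if "h \<in> ?H" for h
    proof -
      have "h \<in> carrier R"
        using that by (simp add: stabilizer_def)
      then have "h = inv x \<otimes> (x \<otimes> h)"
        using xu xc by (simp add: m_assoc[symmetric])
      then show ?thesis
        using that xc \<open>h \<in> carrier R\<close> by (auto simp: l_coset_def)
    qed
    then show ?thesis
      by (auto simp: l_coset_def)
  qed
  ultimately show ?thesis
    using finite_dimensionI by simp
qed

text \<open>The stabilizer acts on the \<open>k\<close>-span by its very definition, which makes
  that span a space over the stabilizer; the other inclusion comes from \<open>k\<close> lying in
  the stabilizer.\<close>

lemma (in cring) lin_span_stabilizer: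
  assumes k: "subfield k R" and H: "subfield (stabilizer k X) R" and X: "X \<subseteq> carrier R"
  shows "lin_span (stabilizer k X) X = lin_span k X"
proof
  note V = subalgebraD[OF lin_span_is_subalgebra[OF k X]]
  have "subalgebra (stabilizer k X) (lin_span k X) R"
    using V by (intro subalgebraI[OF H]) (auto simp: stabilizer_def l_coset_def)
  then show "lin_span (stabilizer k X) X \<subseteq> lin_span k X"
    using lin_span_minimal[OF H] lin_span_incl[OF k X] by blast
  have "subalgebra k (lin_span (stabilizer k X) X) R"
    using subalgebra_restrict_scalars lin_span_is_subalgebra[OF H X]
      subfield_subset_stabilizer[OF k X] by blast
  then show "lin_span k X \<subseteq> lin_span (stabilizer k X) X"
    using lin_span_minimal[OF k] lin_span_incl[OF H X] by blast
qed

section \<open>The three conditions\<close>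

text \<open>Absence of zero divisors keeps the product away from zero. The nonzero element obtained
  in this way is what makes the stabilizer finite-dimensional.\<close>

lemma (in domain) minkowski_prod_nonzero:
  assumes "\<forall>i\<in>{1..n}. finite (A i) \<and> A i \<noteq> {} \<and> A i \<subseteq> carrier R - {\<zero>}"
  shows "finite (minkowski_prod A n) \<and> minkowski_prod A n \<noteq> {} \<and>
    minkowski_prod A n \<subseteq> carrier R - {\<zero>}"
  using assms
proof (induction n)
  case 0
  then show ?case by simp
next
  case (Suc n)
  let ?P = "minkowski_prod A n"
  have P: "finite ?P" "?P \<noteq> {}" "?P \<subseteq> carrier R - {\<zero>}"
    using Suc by auto
  have A: "finite (A (Suc n))" "A (Suc n) \<noteq> {}" "A (Suc n) \<subseteq> carrier R - {\<zero>}"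
    using Suc.prems by auto
  have "x \<otimes> y \<in> carrier R - {\<zero>}" if "x \<in> ?P" "y \<in> A (Suc n)" for x y
    using that P(3) A(3) integral_iff[of x y] by auto
  then show ?case
    using P(1,2) A(1,2) by (auto simp: set_mult_def)
qed

section \<open>Comparison of the conditions for a fixed extension\<close>

context field
begin

context
  fixes k and n :: nat and A
  assumes k: "subfield k R"
    and A: "\<forall>i\<in>{1..n}. finite (A i) \<and> A i \<noteq> {} \<and> A i \<subseteq> carrier R - {\<zero>}"
begin

private abbreviation "P \<equiv> minkowski_prod A n"
private abbreviation "H \<equiv> stabilizer k P"

private lemma P: "P \<subseteq> carrier R" "finite P"
  using minkowski_prod_nonzero[OF A] by auto

private lemma H: "subfield H R"
  using subfield_stabilizer[OF k P] .

private lemma k_H: "k \<subseteq> H"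
  using subfield_subset_stabilizer[OF k P(1)] .

private lemma fin_H: "finite_dimension k H"
proof -
  obtain x where "x \<in> P" "x \<noteq> \<zero>"
    using minkowski_prod_nonzero[OF A] by fast
  then show ?thesis
    using finite_dimension_stabilizer[OF k P] by blast
qed

private lemma span_dim_H: "span_dim k H = dim k H"
  using lin_span_subalgebra_eq[OF k finite_dimension_imp_subalgebra[OF k fin_H]]
  by (simp add: span_dim_def)

text \<open>The tower law is applied to the \<open>H\<close>-span of \<open>A i\<close>, which is
  also the \<open>k\<close>-span of \<open>A i <#> H\<close>.\<close>

private lemma A_mult_H:
  assumes "i \<in> {1..n}"
  shows "finite_dimension k (lin_span k (A i <#> H))"
    and "span_dim k (A i <#> H) = dim k H * span_dim H (A i)"
proof -
  have Ai: "A i \<subseteq> carrier R" "finite (A i)"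
    using A assms by auto
  show "finite_dimension k (lin_span k (A i <#> H))"
    "span_dim k (A i <#> H) = dim k H * span_dim H (A i)"
    using telescopic_base_dim[OF k H fin_H finite_dimension_lin_span[OF H Ai]]
    by (simp_all add: span_dim_def over_def lin_span_set_mult_subfield[OF k H k_H Ai(1)])
qed

text \<open>Since \<open>H\<close> contains one, each \<open>A i\<close> lies in
  \<open>A i <#> H\<close>, so the lower bound in condition 1 is at least the one in condition
  2.\<close>

lemma cond1_imp_cond2:
  assumes "cond1 k n A"
  shows "cond2 k n A"
proof -
  have "span_dim k (A i) \<le> span_dim k (A i <#> H)" if i: "i \<in> {1..n}" for i
  proof (rule span_dim_mono[OF k A_mult_H(1)[OF i]])
    have Ai: "A i \<subseteq> carrier R"
      using A i by auto
    show "A i <#> H \<subseteq> carrier R"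
      using set_mult_closed[OF Ai] subfieldE(3)[OF H] by blast
    show "A i \<subseteq> A i <#> H"
    proof
      fix x assume "x \<in> A i"
      moreover have "x = x \<otimes> \<one>"
        using \<open>x \<in> A i\<close> Ai by auto
      moreover have "\<one> \<in> H"
        using subringE(3)[OF subfieldE(1)[OF H]] .
      ultimately show "x \<in> A i <#> H"
        unfolding set_mult_def by blast
    qed
  qed
  then have "(\<Sum>i=1..n. int (span_dim k (A i))) \<le> (\<Sum>i=1..n. int (span_dim k (A i <#> H)))"
    by (intro sum_mono) simp
  then show ?thesis
    using assms by (simp add: cond1_def cond2_def Let_def)
qed

text \<open>If \<open>H = k\<close>, then \<open>H\<close> has dimension one and condition 2 is the
  first alternative of condition 3; otherwise the product is periodic by definition.\<close>

lemma cond2_imp_cond3: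
  assumes "cond2 k n A"
  shows "cond3 k n A"
proof (cases "H = k")
  case True
  have "span_dim k k = 1"
    using span_dim_H True dimI[OF k dimension_one[OF k]] by (simp add: over_def)
  then show ?thesis
    using assms True by (simp add: cond2_def cond3_def Let_def)
next
  case False
  then show ?thesis
    by (simp add: cond3_def Let_def periodic_def)
qed

text \<open>Only the base field changes from \<open>k\<close> to \<open>H\<close>: the Minkowski
  product is the same set over both.\<close>

lemma cond3_stabilizer_imp_cond1:
  assumes "cond3 H n A"
  shows "cond1 k n A"
proof -
  have span: "lin_span H P = lin_span k P"
    using lin_span_stabilizer[OF k H P(1)] .
  \<comment> \<open>A stabilizer depends only on the span, so the equality of spans gives
    \<open>stabilizer H P = H\<close>, and the periodic alternative is excluded over
    \<open>H\<close>.\<close>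
  then have "\<not> periodic H P"
    by (simp add: periodic_def stabilizer_def)
  then have "(\<Sum>i=1..n. int (span_dim H (A i))) - (int n - 1) \<le> int (span_dim H P)"
    using assms by (simp add: cond3_def Let_def)
  \<comment> \<open>Scaling by the degree of \<open>H\<close> over \<open>k\<close> turns the loss
    \<open>n - 1\<close> into the loss \<open>(n - 1) * dim k H\<close> of condition 1.\<close>
  then have "int (dim k H) * ((\<Sum>i=1..n. int (span_dim H (A i))) - (int n - 1))
      \<le> int (dim k H) * int (span_dim H P)"
    by (intro mult_left_mono) auto
  moreover have "span_dim k P = dim k H * span_dim H P"
    using telescopic_base_dim(2)[OF k H fin_H finite_dimension_lin_span[OF H P]]
    by (simp add: span_dim_def over_def span)
  moreover have "(\<Sum>i=1..n. int (span_dim k (A i <#> H)))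
      = int (dim k H) * (\<Sum>i=1..n. int (span_dim H (A i)))"
    by (simp add: sum_distrib_left A_mult_H(2))
  ultimately show ?thesis
    by (simp add: cond1_def Let_def span_dim_H algebra_simps)
qed

lemma subfield_stabilizer_minkowski_prod: "subfield (stabilizer k (minkowski_prod A n)) R"
  using H .

end

text \<open>The two-factor case is applied to the product of the first \<open>n\<close> sets and the
  next set. If the whole product is not periodic, neither is the partial one; the two inequalities
  then add up, with losses \<open>n - 1\<close> and \<open>1\<close> giving
  \<open>n\<close>.\<close>

lemma cond3_two_imp_cond3:
  assumes k: "subfield k R"
    and two: "\<And>B. \<forall>i\<in>{1..2}. finite (B i) \<and> B i \<noteq> {} \<and> B i \<subseteq> carrier R - {\<zero>} \<Longrightarrow> cond3 k 2 B"
    and "n \<ge> 1" "\<forall>i\<in>{1..n}. finite (A i) \<and> A i \<noteq> {} \<and> A i \<subseteq> carrier R - {\<zero>}"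
  shows "cond3 k n A"
  using assms(3,4)
proof (induction n rule: nat_induct_at_least)
  case base
  have "A 1 \<subseteq> carrier R"
    using base by auto
  \<comment> \<open>The recursive product starts from \<open>{\<one>}\<close>; with a single factor
    the loss is zero and the inequality is an equality.\<close>
  then have "{\<one>} <#> A 1 = A 1"
    by (force simp: set_mult_def)
  then show ?case
    by (simp add: cond3_def Let_def)
next
  case (Suc n)
  let ?Q = "minkowski_prod A n" and ?B = "A (Suc n)"
  have Q: "finite ?Q" "?Q \<noteq> {}" "?Q \<subseteq> carrier R - {\<zero>}"
    using minkowski_prod_nonzero[of n A] Suc.prems by auto
  have B: "finite ?B" "?B \<noteq> {}" "?B \<subseteq> carrier R - {\<zero>}"
    using Suc.prems by auto
  \<comment> \<open>Families are indexed from 1, so \<open>F\<close> presents the pair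
    \<open>?Q\<close>, \<open>?B\<close> at the indices 1 and 2.\<close>
  define F where "F = (\<lambda>i::nat. if i = 1 then ?Q else ?B)"
  have "{\<one>} <#> ?Q = ?Q"
    using Q(3) by (force simp: set_mult_def)
  then have prod: "minkowski_prod F 2 = ?Q <#> ?B"
    by (simp add: F_def numeral_2_eq_2)
  have "(\<Sum>i=1..2. int (span_dim k (F i))) = int (span_dim k ?Q) + int (span_dim k ?B)"
    by (simp add: F_def numeral_2_eq_2)
  moreover have "cond3 k 2 F"
    using Q B by (intro two) (auto simp: F_def)
  ultimately have step: "int (span_dim k (?Q <#> ?B)) \<ge> int (span_dim k ?Q) + int (span_dim k ?B) - 1
      \<or> periodic k (?Q <#> ?B)"
    by (simp add: cond3_def Let_def prod)
  have IH: "cond3 k n A"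
    using Suc by simp
  \<comment> \<open>In this chain, a first inclusion that is strict forces the last stabilizer to
    differ from \<open>k\<close>, which is how periodicity passes to the longer product.\<close>
  have "k \<subseteq> stabilizer k ?Q" "stabilizer k ?Q \<subseteq> stabilizer k (?Q <#> ?B)"
    using subfield_subset_stabilizer[OF k, of ?Q] Q(3) B(3)
      stabilizer_subset_stabilizer_set_mult[OF k, of ?Q ?B] by blast+
  then have "periodic k ?Q \<Longrightarrow> periodic k (?Q <#> ?B)"
    unfolding periodic_def by blast
  then show ?case
    using step IH by (auto simp: cond3_def Let_def)
qed

end

section \<open>Quantification over all extensions and families\<close>

lemma holds_for_all_cond1_imp_cond2:
  assumes "holds_for_all (ring.cond1 :: 'a ring \<Rightarrow> _) N"
  shows "holds_for_all (ring.cond2 :: 'a ring \<Rightarrow> _) N"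
  using assms unfolding holds_for_all_def
  by (intro allI impI field.cond1_imp_cond2) simp_all

lemma holds_for_all_cond2_imp_cond3:
  assumes "holds_for_all (ring.cond2 :: 'a ring \<Rightarrow> _) N"
  shows "holds_for_all (ring.cond3 :: 'a ring \<Rightarrow> _) N"
  using assms unfolding holds_for_all_def
  by (intro allI impI field.cond2_imp_cond3) simp_all

text \<open>Here the quantification over base fields matters: condition 1 over \<open>k\<close>
  comes from condition 3 over the stabilizer, inside the same \<open>K\<close> and for the same
  family. As \<open>n\<close> is unchanged, the argument works for any \<open>N\<close>.\<close>

lemma holds_for_all_cond3_imp_cond1:
  assumes "holds_for_all (ring.cond3 :: 'a ring \<Rightarrow> _) N"
  shows "holds_for_all (ring.cond1 :: 'a ring \<Rightarrow> _) N"
  using assms unfolding holds_for_all_def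
  by (intro allI impI field.cond3_stabilizer_imp_cond1)
    (simp_all add: field.subfield_stabilizer_minkowski_prod)

lemma holds_for_all_cond3_two_iff:
  "holds_for_all (ring.cond3 :: 'a ring \<Rightarrow> _) {2} \<longleftrightarrow> holds_for_all (ring.cond3 :: 'a ring \<Rightarrow> _) {1..}"
proof
  assume two: "holds_for_all (ring.cond3 :: 'a ring \<Rightarrow> _) {2}"
  show "holds_for_all (ring.cond3 :: 'a ring \<Rightarrow> _) {1..}"
    unfolding holds_for_all_def
  proof (intro allI impI)
    fix K :: "'a ring" and k and n :: nat and A
    assume "field K" and k: "subfield k K" and n: "1 \<le> n"
      and A: "\<forall>i\<in>{1..n}. finite (A i) \<and> A i \<noteq> {} \<and> A i \<subseteq> carrier K - {\<zero>\<^bsub>K\<^esub>}"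
    then interpret field K by simp
    show "cond3 k n A"
      using two \<open>field K\<close> k unfolding holds_for_all_def
      by (intro cond3_two_imp_cond3[OF k _ n A]) simp
  qed
next
  assume "holds_for_all (ring.cond3 :: 'a ring \<Rightarrow> _) {1..}"
  then show "holds_for_all (ring.cond3 :: 'a ring \<Rightarrow> _) {2}"
    unfolding holds_for_all_def by simp
qed

theorem theorem2p7:
  shows "(S1 TYPE('a) \<longleftrightarrow> S2 TYPE('a)) \<and>
         (S2 TYPE('a) \<longleftrightarrow> S3 TYPE('a)) \<and>
         (S3 TYPE('a) \<longleftrightarrow> S1' TYPE('a)) \<and>
         (S1' TYPE('a) \<longleftrightarrow> S2' TYPE('a)) \<and>
         (S2' TYPE('a) \<longleftrightarrow> S3' TYPE('a))"
  unfolding S1_def S2_def S3_def S1'_def S2'_def S3'_def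
  \<comment> \<open>For each of the index sets \<open>{1..}\<close> and \<open>{2}\<close> the
    conditions form a cycle 1, 2, 3, 1; the equivalence for condition 3 joins the two
    cycles.\<close>
  using holds_for_all_cond1_imp_cond2 holds_for_all_cond2_imp_cond3
    holds_for_all_cond3_imp_cond1 holds_for_all_cond3_two_iff by blast

end
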